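(* The $9\times 9$ matrix $$\check R(x)=\begin{bmatrix} x^2-x+1&0&0&0&0&0&0&0&0\\ 0&x&0&0&0&1-x&x(x-1)&0&0\\ 0&0&x&x(x-1)&0&0&0&1-x&0\\ 0&0&1-x&x&0&0&0&x(x-1)&0\\ 0&0&0&0&x^2-x+1&0&0&0&0\\ 0&x(x-1)&0&0&0&x&1-x&0&0\\ 0&1-x&0&0&0&x(x-1)&x&0&0\\ 0&0&x(x-1)&1-x&0&0&0&x&0\\ 0&0&0&0&0&0&0&0&x^2-x+1 \end{bmatrix}$$ satisfies the braiding Yang--Baxter equation $$\check R_{12}(x)\check R_{23}(xz)\check R_{12}(z)=\check R_{23}(z)\check R_{12}(xz)\check R_{23}(x)$$ for all nonzero $x,z\in\mathbb C$, and satisfies the unitarity relation $$\check R(x)\check R(x^{-1})=(x-1+x^{-1})^2\,I\otimes I$$ for all nonzero $x\in\mathbb{C}$.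
   Context: Matrices of size $9\times9$ are operators on $V\otimes V$ with $V=\mathbb C^3$, in the basis $e_i\otimes e_j$ ($1\le i,j\le3$) ordered lexicographically: $e_1\otimes e_1,e_1\otimes e_2,e_1\otimes e_3,e_2\otimes e_1,\dots,e_3\otimes e_3$; $I$ is the identity on $V$. For an operator $M$ on $V\otimes V$, $M_{12}=M\otimes I$ and $M_{23}=I\otimes M$ on $V\otimes V\otimes V$. *)

theory Defs
  imports "Jordan_Normal_Form.Matrix" Complex_Main
begin

text \<open>
  The matrix of the tensor product of two operators in the lexicographically ordered product basis.
  Indices start at 0, so for \<open>V\<close> of dimension 3 the basis vector numbered \<open>3 * i + j\<close> is the
  tensor product of basis vectors \<open>i\<close> and \<open>j\<close>.
\<close>

definition kronecker_prod :: "'a :: semiring_0 mat \<Rightarrow> 'a mat \<Rightarrow> 'a mat"  (infixl "\<otimes>\<^sub>m" 75) where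
  "A \<otimes>\<^sub>m B = mat (dim_row A * dim_row B) (dim_col A * dim_col B)
     (\<lambda>(i, j). A $$ (i div dim_row B, j div dim_col B) * B $$ (i mod dim_row B, j mod dim_col B))"

definition leg12 :: "complex mat \<Rightarrow> complex mat" where
  "leg12 M = M \<otimes>\<^sub>m 1\<^sub>m 3"

definition leg23 :: "complex mat \<Rightarrow> complex mat" where
  "leg23 M = 1\<^sub>m 3 \<otimes>\<^sub>m M"

definition R_check :: "complex \<Rightarrow> complex mat" where
  "R_check x = mat_of_rows_list 9
    [[x^2 - x + 1, 0, 0, 0, 0, 0, 0, 0, 0],
     [0, x, 0, 0, 0, 1 - x, x * (x - 1), 0, 0],
     [0, 0, x, x * (x - 1), 0, 0, 0, 1 - x, 0],
     [0, 0, 1 - x, x, 0, 0, 0, x * (x - 1), 0],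
     [0, 0, 0, 0, x^2 - x + 1, 0, 0, 0, 0],
     [0, x * (x - 1), 0, 0, 0, x, 1 - x, 0, 0],
     [0, 1 - x, 0, 0, 0, x * (x - 1), x, 0, 0],
     [0, 0, x * (x - 1), 1 - x, 0, 0, 0, x, 0],
     [0, 0, 0, 0, 0, 0, 0, 0, x^2 - x + 1]]"

end

theory Submission
  imports Defs
begin

text \<open>
  Read the labels of the basis vectors of \<open>V\<close> modulo 3. The map \<open>t (i, j) = (j, 2 * j - i)\<close> is the
  set-theoretic braiding of the dihedral quandle on three elements: it satisfies the braid
  relation on triples, and, since \<open>3 = 0\<close>, also \<open>t\<^sup>3 = id\<close>. If \<open>P\<close> is its permutation matrix, then
  the \<open>R\<close>-matrix is the cyclic combination \<open>x I + (1 - x) P + x (x - 1) P\<^sup>2\<close>; the diagonal entries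
  \<open>x\<^sup>2 - x + 1\<close> are the sums of the three coefficients at the fixed points of \<open>t\<close>.

  Unitarity is thus an identity in the group algebra of the cyclic group of order 3. For the
  Yang--Baxter equation let \<open>a\<close>, \<open>b\<close> be the two legs of \<open>P\<close> and \<open>A = a\<^sup>2\<close>, \<open>B = b\<^sup>2\<close> their inverses.
  Expanding both sides into words and applying the braid relation, everything cancels except
  \<open>x z (1 - x) (1 - z) (1 - x z)\<close> times
  \[ b + A + aB + Ba + AbA + bAb - (a + B + Ab + bA + aBa + BaB). \]
  This element is not zero in the group algebra of \<open>SL(2,3)\<close>, the quotient of the braid group by
  \<open>a\<^sup>3 = 1\<close>, but it acts as zero in the present representation
  (\<open>twelve_term_relation\<close>). Indeed \<open>i - j + k\<close> is invariant on triples \<open>(i, j, k)\<close>, and in the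
  coordinates \<open>(p, q) = (j - i, k - j)\<close> each of the three level sets is the plane over the field with
  three elements, with \<open>SL(2,3)\<close> acting linearly. The six negative words send a vector to the
  negatives of its images under the six positive words, and for each vector these images, counted with
  multiplicity, are closed under negation.
\<close>

section \<open>Cyclic combinations of a map\<close>

definition cyclic_mat ::
    "nat \<Rightarrow> (nat \<Rightarrow> nat) \<Rightarrow> 'a \<Rightarrow> 'a \<Rightarrow> 'a \<Rightarrow> 'a :: comm_ring_1 mat" where
  "cyclic_mat n t c d e = mat n n (\<lambda>(i, j).
     c * of_bool (j = i) + d * of_bool (j = t i) + e * of_bool (j = t (t i)))"

lemma cyclic_mat_carrier [simp]: "cyclic_mat n t c d e \<in> carrier_mat n n"
  by (simp add: cyclic_mat_def)

lemma dim_cyclic_mat [simp]: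
  "dim_row (cyclic_mat n t c d e) = n" "dim_col (cyclic_mat n t c d e) = n"
  by (simp_all add: cyclic_mat_def)

text \<open>
  Left multiplication only moves row indices, so an entry of a product of cyclic combinations
  unfolds into a sum over words in the underlying maps, applied to the row index.
\<close>

lemma cyclic_mat_mult_index:
  assumes M: "M \<in> carrier_mat n m" and i: "i < n" and j: "j < m"
    and t: "\<And>i. i < n \<Longrightarrow> t i < n"
  shows "(cyclic_mat n t c d e * M) $$ (i, j) =
    c * M $$ (i, j) + d * M $$ (t i, j) + e * M $$ (t (t i), j)"
proof -
  have pick: "(\<Sum>k<n. s * of_bool (k = l) * M $$ (k, j)) = s * M $$ (l, j)"
    if "l < n" for s l
  proof -
    have "(\<Sum>k<n. s * of_bool (k = l) * M $$ (k, j)) =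
        (\<Sum>k<n. if k = l then s * M $$ (k, j) else 0)"
      by (intro sum.cong) auto
    then show ?thesis using that by simp
  qed
  have "(cyclic_mat n t c d e * M) $$ (i, j) =
      (\<Sum>k<n. cyclic_mat n t c d e $$ (i, k) * M $$ (k, j))"
    using M i j by (simp add: scalar_prod_def lessThan_atLeast0)
  also have "\<dots> = (\<Sum>k<n. c * of_bool (k = i) * M $$ (k, j)
      + d * of_bool (k = t i) * M $$ (k, j) + e * of_bool (k = t (t i)) * M $$ (k, j))"
    using i by (intro sum.cong) (simp_all add: cyclic_mat_def distrib_right)
  also have "\<dots> = c * M $$ (i, j) + d * M $$ (t i, j) + e * M $$ (t (t i), j)"
    using i t by (simp add: sum.distrib pick)
  finally show ?thesis .
qed

definition lift_left :: "nat \<Rightarrow> (nat \<Rightarrow> nat) \<Rightarrow> nat \<Rightarrow> nat" where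
  "lift_left m t i = t (i div m) * m + i mod m"

definition lift_right :: "nat \<Rightarrow> (nat \<Rightarrow> nat) \<Rightarrow> nat \<Rightarrow> nat" where
  "lift_right n t i = (i div n) * n + t (i mod n)"

lemma eq_div_mod_iff:
  fixes j a b m :: nat
  assumes "b < m"
  shows "j = a * m + b \<longleftrightarrow> j div m = a \<and> j mod m = b"
  using assms by auto

lemma kronecker_cyclic_one:
  assumes "0 < m"
  shows "cyclic_mat n t c d e \<otimes>\<^sub>m 1\<^sub>m m = cyclic_mat (n * m) (lift_left m t) c d e"
proof (rule eq_matI)
  fix i j
  assume "i < dim_row (cyclic_mat (n * m) (lift_left m t) c d e)"
    and "j < dim_col (cyclic_mat (n * m) (lift_left m t) c d e)"
  then have ij: "i < n * m" "j < n * m" by simp_all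
  then have dm: "i div m < n" "j div m < n" "i mod m < m" "j mod m < m"
    using assms by (simp_all add: less_mult_imp_div_less)
  have id: "j = i \<longleftrightarrow> j div m = i div m \<and> j mod m = i mod m"
    by (metis div_mult_mod_eq)
  show "(cyclic_mat n t c d e \<otimes>\<^sub>m 1\<^sub>m m) $$ (i, j) =
      cyclic_mat (n * m) (lift_left m t) c d e $$ (i, j)"
    using ij dm
    by (auto simp: kronecker_prod_def cyclic_mat_def lift_left_def eq_div_mod_iff id)
qed (simp_all add: kronecker_prod_def)

lemma kronecker_one_cyclic:
  assumes t: "\<And>i. i < n \<Longrightarrow> t i < n"
  shows "1\<^sub>m m \<otimes>\<^sub>m cyclic_mat n t c d e = cyclic_mat (m * n) (lift_right n t) c d e"
proof (rule eq_matI)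
  fix i j
  assume "i < dim_row (cyclic_mat (m * n) (lift_right n t) c d e)"
    and "j < dim_col (cyclic_mat (m * n) (lift_right n t) c d e)"
  then have ij: "i < m * n" "j < m * n" by simp_all
  then have "0 < n" by (cases n) auto
  with ij have dm: "i div n < m" "j div n < m" "i mod n < n" "j mod n < n"
    by (simp_all add: less_mult_imp_div_less)
  have id: "j = i \<longleftrightarrow> j div n = i div n \<and> j mod n = i mod n"
    by (metis div_mult_mod_eq)
  show "(1\<^sub>m m \<otimes>\<^sub>m cyclic_mat n t c d e) $$ (i, j) =
      cyclic_mat (m * n) (lift_right n t) c d e $$ (i, j)"
    using ij dm t
    by (auto simp: kronecker_prod_def cyclic_mat_def lift_right_def eq_div_mod_iff id)
qed (simp_all add: kronecker_prod_def)

section \<open>The Yang--Baxter equation from a twelve-term relation\<close>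

text \<open>
  The map \<open>\<lambda>v. cyclic_sum x h \<phi> v\<close> is the action of \<open>x + (1 - x) h + x (x - 1) h\<^sup>2\<close> on functions;
  \<open>f \<circ> f\<close> and \<open>g \<circ> g\<close> are the inverses of \<open>f\<close> and \<open>g\<close>.
\<close>

definition cyclic_sum :: "'b :: comm_ring_1 \<Rightarrow> ('a \<Rightarrow> 'a) \<Rightarrow> ('a \<Rightarrow> 'b) \<Rightarrow> 'a \<Rightarrow> 'b" where
  "cyclic_sum x h \<phi> v = x * \<phi> v + (1 - x) * \<phi> (h v) + x * (x - 1) * \<phi> (h (h v))"

text \<open>
  The braid relation matches every mixed word on one side with a word on the other, except the
  ones in which inverses alternate. Those, and the shorter words whose coefficients differ, all
  come with the common factor that multiplies the twelve-term relation.
\<close>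

lemma yang_baxter_from_twelve_terms:
  fixes \<phi> :: "'a \<Rightarrow> 'b :: comm_ring_1" and v :: 'a
  assumes v: "v \<in> S"
    and S: "\<And>u. u \<in> S \<Longrightarrow> f u \<in> S" "\<And>u. u \<in> S \<Longrightarrow> g u \<in> S"
    and f3: "\<And>u. u \<in> S \<Longrightarrow> f (f (f u)) = u"
    and g3: "\<And>u. u \<in> S \<Longrightarrow> g (g (g u)) = u"
    and braid: "\<And>u. u \<in> S \<Longrightarrow> g (f (g u)) = f (g (f u))"
    and twelve:
      "\<phi> (g v) + \<phi> (f (f v)) + \<phi> (f (g (g v))) + \<phi> (g (g (f v)))
         + \<phi> (f (f (g (f (f v))))) + \<phi> (g (f (f (g v)))) =
       \<phi> (f v) + \<phi> (g (g v)) + \<phi> (f (f (g v))) + \<phi> (g (f (f v)))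
         + \<phi> (f (g (g (f v)))) + \<phi> (g (g (f (g (g v)))))"
  shows "cyclic_sum x f (cyclic_sum (x * z) g (cyclic_sum z f \<phi>)) v =
    cyclic_sum z g (cyclic_sum (x * z) f (cyclic_sum x g \<phi>)) v"
proof -
  \<comment> \<open>The braid relation with some exponents inverted, oriented so that rewriting brings both
    sides of the equation to the same set of words.\<close>
  have fgF: "f (g (f (f v))) = g (g (f (g v)))"
    by (metis braid S f3 g3 v)
  have Fgf: "f (f (g (f v))) = g (f (g (g v)))"
    by (metis braid S f3 g3 v)
  have fGF: "f (g (g (f (f v)))) = g (g (f (f (g v))))"
    by (metis braid S f3 g3 v)
  have FGf: "f (f (g (g (f v)))) = g (f (f (g (g v))))"
    by (metis braid S f3 g3 v)
  have FGFg: "f (g (g (f (f (g v))))) = g (g (f (f (g (g v)))))"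
    by (metis braid S f3 g3 v)
  note words = f3 [OF v] g3 [OF v] braid [OF v] fgF Fgf fGF FGf FGFg
  have "cyclic_sum x f (cyclic_sum (x * z) g (cyclic_sum z f \<phi>)) v
      - cyclic_sum z g (cyclic_sum (x * z) f (cyclic_sum x g \<phi>)) v =
    x * z * (1 - x) * (1 - z) * (1 - x * z) *
      ((\<phi> (g v) + \<phi> (f (f v)) + \<phi> (f (g (g v))) + \<phi> (g (g (f v)))
         + \<phi> (f (f (g (f (f v))))) + \<phi> (g (f (f (g v)))))
       - (\<phi> (f v) + \<phi> (g (g v)) + \<phi> (f (f (g v))) + \<phi> (g (f (f v)))
         + \<phi> (f (g (g (f v)))) + \<phi> (g (g (f (g (g v)))))))"
    unfolding cyclic_sum_def by (simp only: words) (simp add: algebra_simps)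
  then show ?thesis by (simp add: twelve)
qed

section \<open>The braiding of the dihedral quandle\<close>

text \<open>
  The map \<open>(i, j) \<mapsto> (j, 2 * j - i)\<close> modulo 3, in the lexicographic numbering of pairs.
\<close>

definition quandle_braiding :: "nat \<Rightarrow> nat" where
  "quandle_braiding m = 3 * (m mod 3) + (2 * (m mod 3) + 2 * (m div 3)) mod 3"

lemma quandle_braiding_less [simp]: "quandle_braiding m < 9"
  using mod_less_divisor[of 3 m] mod_less_divisor[of 3 "2 * (m mod 3) + 2 * (m div 3)"]
  unfolding quandle_braiding_def by linarith

lemma less_9_cases:
  "(m::nat) < 9 \<Longrightarrow> m \<in> {0, 1, 2, 3, 4, 5, 6, 7, 8}"
  by auto

lemma R_check_eq_cyclic_mat:
  "R_check x = cyclic_mat 9 quandle_braiding x (1 - x) (x * (x - 1))"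
proof (rule eq_matI)
  fix i j
  assume "i < dim_row (cyclic_mat 9 quandle_braiding x (1 - x) (x * (x - 1)))"
    and "j < dim_col (cyclic_mat 9 quandle_braiding x (1 - x) (x * (x - 1)))"
  then have "i < 9" "j < 9" by simp_all
  then have "i \<in> {0, 1, 2, 3, 4, 5, 6, 7, 8}" "j \<in> {0, 1, 2, 3, 4, 5, 6, 7, 8}"
    by (auto dest: less_9_cases)
  then show "R_check x $$ (i, j) =
      cyclic_mat 9 quandle_braiding x (1 - x) (x * (x - 1)) $$ (i, j)"
    by (elim insertE emptyE; hypsubst;
        simp add: R_check_def mat_of_rows_list_def cyclic_mat_def quandle_braiding_def
          power2_eq_square algebra_simps)
qed (simp_all add: R_check_def mat_of_rows_list_def)

lemma quandle_braiding_cubed: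
  "m < 9 \<Longrightarrow> quandle_braiding (quandle_braiding (quandle_braiding m)) = m"
  by (drule less_9_cases, elim insertE emptyE; simp add: quandle_braiding_def)

abbreviation braid12 :: "nat \<Rightarrow> nat" where
  "braid12 \<equiv> lift_left 3 quandle_braiding"

abbreviation braid23 :: "nat \<Rightarrow> nat" where
  "braid23 \<equiv> lift_right 9 quandle_braiding"

lemma braid12_less [simp]: "braid12 i < 27"
  using quandle_braiding_less[of "i div 3"] mod_less_divisor[of 3 i]
  unfolding lift_left_def by linarith

lemma braid23_less [simp]: "i < 27 \<Longrightarrow> braid23 i < 27"
  using quandle_braiding_less[of "i mod 9"] less_mult_imp_div_less[of i 3 9]
  unfolding lift_right_def by linarith

lemma leg12_R_check:
  "leg12 (R_check x) = cyclic_mat 27 braid12 x (1 - x) (x * (x - 1))"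
  by (simp add: leg12_def R_check_eq_cyclic_mat kronecker_cyclic_one)

lemma leg23_R_check:
  "leg23 (R_check x) = cyclic_mat 27 braid23 x (1 - x) (x * (x - 1))"
  by (simp add: leg23_def R_check_eq_cyclic_mat kronecker_one_cyclic)

lemma less_27_cases:
  "(m::nat) < 27 \<Longrightarrow> m \<in> {0, 1, 2, 3, 4, 5, 6, 7, 8, 9, 10, 11, 12, 13, 14, 15, 16, 17,
     18, 19, 20, 21, 22, 23, 24, 25, 26}"
  unfolding lessThan_iff [symmetric] by (simp add: lessThan_nat_numeral lessThan_Suc, blast)

lemma braid12_cubed: "u < 27 \<Longrightarrow> braid12 (braid12 (braid12 u)) = u"
  by (simp add: lift_left_def quandle_braiding_cubed less_mult_imp_div_less)

lemma braid23_cubed: "u < 27 \<Longrightarrow> braid23 (braid23 (braid23 u)) = u"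
  by (simp add: lift_right_def quandle_braiding_cubed)

lemma braid_relation:
  "u < 27 \<Longrightarrow> braid23 (braid12 (braid23 u)) = braid12 (braid23 (braid12 u))"
  by (drule less_27_cases, elim insertE emptyE;
      simp add: lift_left_def lift_right_def quandle_braiding_def)

text \<open>
  In the coordinates \<open>(p, q)\<close> of differences, the words on the left send a vector to
  \<open>(p + q, q)\<close>, \<open>(p, p + q)\<close>, \<open>(p - q, -p - q)\<close>, \<open>(-p - q, q - p)\<close>, \<open>(q - p, -q)\<close>, \<open>(-p, p - q)\<close>, and
  those on the right to the negatives of these. Modulo 3, both lists agree up to order; each of
  the 27 triples is a direct computation.
\<close>

lemma twelve_term_relation:
  fixes \<phi> :: "nat \<Rightarrow> 'b :: comm_ring_1"
  assumes "v < 27"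
  shows
    "\<phi> (braid23 v) + \<phi> (braid12 (braid12 v))
       + \<phi> (braid12 (braid23 (braid23 v))) + \<phi> (braid23 (braid23 (braid12 v)))
       + \<phi> (braid12 (braid12 (braid23 (braid12 (braid12 v)))))
       + \<phi> (braid23 (braid12 (braid12 (braid23 v)))) =
     \<phi> (braid12 v) + \<phi> (braid23 (braid23 v))
       + \<phi> (braid12 (braid12 (braid23 v))) + \<phi> (braid23 (braid12 (braid12 v)))
       + \<phi> (braid12 (braid23 (braid23 (braid12 v))))
       + \<phi> (braid23 (braid23 (braid12 (braid23 (braid23 v)))))"
  using less_27_cases[OF assms]
  by (elim insertE emptyE; hypsubst;
      simp add: lift_left_def lift_right_def quandle_braiding_def)

section \<open>Yang--Baxter equation and unitarity\<close>

lemma triple_product_index: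
  fixes x y z :: "'a :: comm_ring_1"
  assumes f: "\<And>i. i < n \<Longrightarrow> f i < n" and g: "\<And>i. i < n \<Longrightarrow> g i < n"
    and i: "i < n" and j: "j < n"
  shows "(cyclic_mat n f x (1 - x) (x * (x - 1)) * cyclic_mat n g y (1 - y) (y * (y - 1))
      * cyclic_mat n f z (1 - z) (z * (z - 1))) $$ (i, j) =
    cyclic_sum x f (cyclic_sum y g (cyclic_sum z f (\<lambda>k. of_bool (j = k)))) i"
proof -
  let ?X = "cyclic_mat n f x (1 - x) (x * (x - 1))"
  let ?Y = "cyclic_mat n g y (1 - y) (y * (y - 1))"
  let ?Z = "cyclic_mat n f z (1 - z) (z * (z - 1))"
  have Z: "?Z $$ (k, j) = cyclic_sum z f (\<lambda>k. of_bool (j = k)) k" if "k < n" for k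
    using that j by (simp add: cyclic_mat_def cyclic_sum_def)
  have YZ: "(?Y * ?Z) $$ (k, j) = cyclic_sum y g (cyclic_sum z f (\<lambda>k. of_bool (j = k))) k"
    if "k < n" for k
    using that j g
    by (simp add: cyclic_mat_mult_index[where m = n] Z cyclic_sum_def[of y] del: index_mult_mat)
  have "?X * ?Y * ?Z = ?X * (?Y * ?Z)"
    by (rule assoc_mult_mat[of _ n n _ n _ n]) simp_all
  then show ?thesis
    using i j f
    by (simp add: cyclic_mat_mult_index[where m = n] mult_carrier_mat[of _ n n _ n] YZ
        cyclic_sum_def[of x] del: index_mult_mat)
qed

lemma R_check_yang_baxter:
  "leg12 (R_check x) * leg23 (R_check (x * z)) * leg12 (R_check z) =
   leg23 (R_check z) * leg12 (R_check (x * z)) * leg23 (R_check x)"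
  (is "?L = ?R")
proof (rule eq_matI)
  fix i j assume "i < dim_row ?R" "j < dim_col ?R"
  then have ij: "i < 27" "j < 27" by (simp_all add: leg23_R_check)
  show "?L $$ (i, j) = ?R $$ (i, j)"
    unfolding leg12_R_check leg23_R_check
    using ij
    by (subst (1 2) triple_product_index)
      (auto intro!: yang_baxter_from_twelve_terms[where S = "{..<27}"] twelve_term_relation
        simp: braid12_cubed braid23_cubed braid_relation)
qed (simp_all add: leg12_R_check leg23_R_check)

text \<open>
  In the group algebra of the cyclic group, the product of the combinations for arbitrary \<open>x\<close> and
  \<open>y\<close> differs from the scalar \<open>(x - 1 + y)\<^sup>2\<close> by a multiple of \<open>x * y - 1\<close>.
\<close>

lemma R_check_unitary:
  assumes "x \<noteq> 0"
  shows "R_check x * R_check (inverse x) = (x - 1 + inverse x)^2 \<cdot>\<^sub>m (1\<^sub>m 3 \<otimes>\<^sub>m 1\<^sub>m 3)"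
proof -
  define y where "y = inverse x"
  have xy: "x * y = 1" using assms by (simp add: y_def)
  have one: "1\<^sub>m 3 \<otimes>\<^sub>m 1\<^sub>m 3 = (1\<^sub>m 9 :: complex mat)"
  proof (rule eq_matI)
    fix i j assume "i < dim_row (1\<^sub>m 9 :: complex mat)" "j < dim_col (1\<^sub>m 9 :: complex mat)"
    then have ij: "i < 9" "j < 9" by simp_all
    moreover have "i = j \<longleftrightarrow> i div 3 = j div 3 \<and> i mod 3 = j mod 3"
      by (metis div_mult_mod_eq)
    ultimately show "(1\<^sub>m 3 \<otimes>\<^sub>m 1\<^sub>m 3) $$ (i, j) = (1\<^sub>m 9 :: complex mat) $$ (i, j)"
      by (auto simp: kronecker_prod_def less_mult_imp_div_less)
  qed (simp_all add: kronecker_prod_def)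
  have "R_check x * R_check y = (x - 1 + y)^2 \<cdot>\<^sub>m 1\<^sub>m 9"
  proof (rule eq_matI)
    fix i j
    assume "i < dim_row ((x - 1 + y)^2 \<cdot>\<^sub>m 1\<^sub>m 9)" "j < dim_col ((x - 1 + y)^2 \<cdot>\<^sub>m 1\<^sub>m 9)"
    then have ij: "i < 9" "j < 9" by simp_all
    let ?t = quandle_braiding
    define p q r :: complex where
      "p = of_bool (j = i)" and "q = of_bool (j = ?t i)" and "r = of_bool (j = ?t (?t i))"
    have "(R_check x * R_check y) $$ (i, j) =
        x * (y * p + (1 - y) * q + y * (y - 1) * r)
        + (1 - x) * (y * q + (1 - y) * r + y * (y - 1) * p)
        + x * (x - 1) * (y * r + (1 - y) * p + y * (y - 1) * q)"
      unfolding R_check_eq_cyclic_mat using ij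
      by (simp add: cyclic_mat_mult_index[where m = 9] del: index_mult_mat)
        (simp add: cyclic_mat_def quandle_braiding_cubed p_def q_def r_def)
    also have "\<dots> = (x - 1 + y)^2 * p
        + (x * y - 1) * ((1 - x - y) * p + (x * y - x - y) * q + (x + y - 1) * r)"
      by (simp add: power2_eq_square algebra_simps)
    also have "\<dots> = (x - 1 + y)^2 * p"
      using xy by simp
    finally show "(R_check x * R_check y) $$ (i, j) = ((x - 1 + y)^2 \<cdot>\<^sub>m 1\<^sub>m 9) $$ (i, j)"
      using ij by (auto simp: p_def)
  qed (simp_all add: R_check_eq_cyclic_mat)
  then show ?thesis by (simp add: one y_def)
qed

theorem mainTheorem5:
  shows "(\<forall>x z :: complex. x \<noteq> 0 \<longrightarrow> z \<noteq> 0 \<longrightarrow>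
            leg12 (R_check x) * leg23 (R_check (x * z)) * leg12 (R_check z)
            = leg23 (R_check z) * leg12 (R_check (x * z)) * leg23 (R_check x))
       \<and> (\<forall>x :: complex. x \<noteq> 0 \<longrightarrow>
            R_check x * R_check (inverse x)
            = (x - 1 + inverse x)^2 \<cdot>\<^sub>m (1\<^sub>m 3 \<otimes>\<^sub>m 1\<^sub>m 3))"
  using R_check_yang_baxter R_check_unitary by blast

end
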